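(* Let $m>n\ge2$ be integers, let $\Lambda\subseteq\{0,\ldots,m-1\}\times\{0,\ldots,n-1\}$ be nonempty, and let $u\in\mathbb{Z}$. Then $$\Delta(u)=\frac1{\log m}\max_{\boldsymbol\sigma\in\mathscr P(\mathcal I)}\ \min_{0\le\lambda\le1}\big\{h(\boldsymbol\sigma)+\lambda N(\boldsymbol\sigma)+(\tau-\lambda)c_u\big\}$$ $$=\frac1{\log m}\max_{\boldsymbol\sigma\in\mathscr P(\mathcal I)}\big\{h(\boldsymbol\sigma)+(\tau-1)c_u+\min\{N(\boldsymbol\sigma),c_u\}\big\}.$$
   Context: For $i\in\{0,\ldots,m-1\}$ let $N_i=\#\{j:(i,j)\in\Lambda\}$ and $\mathcal I=\{i:N_i>0\}$. Put $\tau=\log m/\log n>1$. For $u\in\mathbb{Z}$: $\eta(0)=\max\{1,N_0\}$, $\eta(-1)=\max\{1,N_{m-1}\}$, $\eta(u)=1$ otherwise; $c_u=\log\eta(u)$. Define $$\Delta(u)=\frac1{\log m}\min_{0\le\lambda\le1}\Big\{\log\sum_{i\in\mathcal I}N_i^\lambda+(\tau-\lambda)c_u\Big\}.$$ $\mathscr P(\mathcal I)$ is the set of probability vectors $\boldsymbol\sigma=(\sigma_i)_{i\in\mathcal I}$, and $h(\boldsymbol\sigma)=-\sum_{i\in\mathcal I}\sigma_i\log\sigma_i$ (with $0\log0=0$), $N(\boldsymbol\sigma)=\sum_{i\in\mathcal I}\sigma_i\log N_i$. *)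

theory Defs
  imports "HOL-Analysis.Analysis"
begin

definition row_count :: "(nat \<times> nat) set \<Rightarrow> nat \<Rightarrow> nat" where
  "row_count \<Lambda> i = card {j. (i, j) \<in> \<Lambda>}"

definition occupied :: "nat \<Rightarrow> (nat \<times> nat) set \<Rightarrow> nat set" where
  "occupied m \<Lambda> = {i \<in> {0..<m}. row_count \<Lambda> i > 0}"

definition tau :: "nat \<Rightarrow> nat \<Rightarrow> real" where
  "tau m n = ln (real m) / ln (real n)"

definition eta :: "nat \<Rightarrow> (nat \<times> nat) set \<Rightarrow> int \<Rightarrow> nat" where
  "eta m \<Lambda> u =
     (if u = 0 then max 1 (row_count \<Lambda> 0)
      else if u = -1 then max 1 (row_count \<Lambda> (m - 1))
      else 1)"

definition log_eta :: "nat \<Rightarrow> (nat \<times> nat) set \<Rightarrow> int \<Rightarrow> real" where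
  "log_eta m \<Lambda> u = ln (real (eta m \<Lambda> u))"

definition pressure :: "nat \<Rightarrow> nat \<Rightarrow> (nat \<times> nat) set \<Rightarrow> int \<Rightarrow> real \<Rightarrow> real" where
  "pressure m n \<Lambda> u l =
     ln (\<Sum>i\<in>occupied m \<Lambda>. real (row_count \<Lambda> i) powr l) + (tau m n - l) * log_eta m \<Lambda> u"

text \<open>Minima and maxima are written as infima and suprema of real-valued functions. These are
  genuine extrema only when attained; attainment is asserted alongside each use, by means of
  \<^const>\<open>is_arg_min\<close> and \<^const>\<open>is_arg_max\<close>.\<close>

definition Delta :: "nat \<Rightarrow> nat \<Rightarrow> (nat \<times> nat) set \<Rightarrow> int \<Rightarrow> real" where
  "Delta m n \<Lambda> u = 1 / ln (real m) * (INF l\<in>{0..1}. pressure m n \<Lambda> u l)"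

text \<open>Vectors indexed by \<open>I\<close> are extensional functions, i.e. \<^const>\<open>undefined\<close> outside \<open>I\<close>.\<close>

definition prob_vectors :: "nat set \<Rightarrow> (nat \<Rightarrow> real) set" where
  "prob_vectors I = {\<sigma> \<in> I \<rightarrow>\<^sub>E {0..}. (\<Sum>i\<in>I. \<sigma> i) = 1}"

text \<open>The convention \<open>0 log 0 = 0\<close> holds because a product with factor \<open>0\<close> is \<open>0\<close>.\<close>

definition entropy :: "nat set \<Rightarrow> (nat \<Rightarrow> real) \<Rightarrow> real" where
  "entropy I \<sigma> = - (\<Sum>i\<in>I. \<sigma> i * ln (\<sigma> i))"

definition mean_log_count :: "nat \<Rightarrow> (nat \<times> nat) set \<Rightarrow> (nat \<Rightarrow> real) \<Rightarrow> real" where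
  "mean_log_count m \<Lambda> \<sigma> = (\<Sum>i\<in>occupied m \<Lambda>. \<sigma> i * ln (real (row_count \<Lambda> i)))"

definition tilted :: "nat \<Rightarrow> nat \<Rightarrow> (nat \<times> nat) set \<Rightarrow> int \<Rightarrow> (nat \<Rightarrow> real) \<Rightarrow> real \<Rightarrow> real" where
  "tilted m n \<Lambda> u \<sigma> l =
     entropy (occupied m \<Lambda>) \<sigma> + l * mean_log_count m \<Lambda> \<sigma> + (tau m n - l) * log_eta m \<Lambda> u"

definition truncated :: "nat \<Rightarrow> nat \<Rightarrow> (nat \<times> nat) set \<Rightarrow> int \<Rightarrow> (nat \<Rightarrow> real) \<Rightarrow> real" where
  "truncated m n \<Lambda> u \<sigma> =
     entropy (occupied m \<Lambda>) \<sigma> + (tau m n - 1) * log_eta m \<Lambda> u + min (mean_log_count m \<Lambda> \<sigma>) (log_eta m \<Lambda> u)"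

end

theory Submission imports Defs begin

text \<open>Gibbs' inequality makes every tilted functional a lower bound for the pressure, so only one
  \<open>\<sigma>\<close> attaining equality is needed. Let \<open>l\<close> minimise the pressure over \<open>[0, 1]\<close> and let \<open>\<sigma>\<close> be the Gibbs
  vector with weights proportional to \<open>N\<^sub>i powr l\<close>. The derivative of the pressure at \<open>l\<close> is the slope of
  the affine function \<open>tilted \<sigma>\<close>, so the first-order condition for \<open>l\<close> says precisely that \<open>l\<close> also
  minimises \<open>tilted \<sigma>\<close>, where the two functions agree. No minimax theorem or compactness of the
  simplex is used.\<close>

text \<open>Apply \<open>ln x \<le> x - 1\<close> at \<open>x = w i / (Z * \<sigma> i)\<close>, with
  \<open>Z\<close> the total weight, multiply by \<open>\<sigma> i\<close> and sum: the upper bounds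
  add up to \<open>1 - 1 = 0\<close>.\<close>

lemma entropy_add_mean_le_ln_sum:
  assumes "finite I" and "\<And>i. i \<in> I \<Longrightarrow> \<sigma> i \<ge> 0" and "(\<Sum>i\<in>I. \<sigma> i) = 1"
    and w: "\<And>i. i \<in> I \<Longrightarrow> w i > 0"
  shows "entropy I \<sigma> + (\<Sum>i\<in>I. \<sigma> i * ln (w i)) \<le> ln (\<Sum>i\<in>I. w i)"
proof -
  define Z where "Z = (\<Sum>i\<in>I. w i)"
  have "I \<noteq> {}"
    using assms(3) by auto
  then have Z: "Z > 0"
    unfolding Z_def using assms(1) w by (intro sum_pos) auto
  have pointwise: "\<sigma> i * ln (w i) - \<sigma> i * ln (\<sigma> i) - \<sigma> i * ln Z \<le> w i / Z - \<sigma> i" if "i \<in> I" for i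
  \<comment> \<open>Zero entries are split off because the logarithmic bound divides by
    \<open>\<sigma> i\<close>; for them the claim is just \<open>0 \<le> w i / Z\<close>.\<close>
  proof (cases "\<sigma> i = 0")
    case True
    then show ?thesis using w[OF that] Z by simp
  next
    case False
    then have s: "\<sigma> i > 0" using assms(2)[OF that] by simp
    have "ln (w i) - ln Z - ln (\<sigma> i) = ln (w i / (Z * \<sigma> i))"
      using s Z w[OF that] by (simp add: ln_div ln_mult)
    also have "\<dots> \<le> w i / (Z * \<sigma> i) - 1"
      using s Z w[OF that] by (intro ln_le_minus_one) auto
    finally have "\<sigma> i * (ln (w i) - ln Z - ln (\<sigma> i)) \<le> \<sigma> i * (w i / (Z * \<sigma> i) - 1)"
      using s by (intro mult_left_mono) auto
    also have "\<dots> = w i / Z - \<sigma> i"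
      using s by (simp add: right_diff_distrib)
    finally show ?thesis
      by (simp add: algebra_simps)
  qed
  have "(\<Sum>i\<in>I. \<sigma> i * ln (w i)) - (\<Sum>i\<in>I. \<sigma> i * ln (\<sigma> i)) - (\<Sum>i\<in>I. \<sigma> i) * ln Z
      \<le> (\<Sum>i\<in>I. w i) / Z - (\<Sum>i\<in>I. \<sigma> i)"
    using sum_mono[OF pointwise]
    by (simp add: sum_subtractf sum_divide_distrib sum_distrib_right)
  then show ?thesis
    using Z assms(3) by (simp add: entropy_def flip: Z_def)
qed

text \<open>Here \<open>ln (\<sigma> i) = ln (w i) - ln Z\<close>, so the \<open>ln (w i)\<close>
  terms cancel and \<open>ln Z\<close> times the total mass 1 remains.\<close>

lemma entropy_add_mean_gibbs:
  assumes "finite I" and "I \<noteq> {}" and w: "\<And>i. i \<in> I \<Longrightarrow> w i > 0"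
    and \<sigma>: "\<And>i. i \<in> I \<Longrightarrow> \<sigma> i = w i / (\<Sum>i\<in>I. w i)"
  shows "entropy I \<sigma> + (\<Sum>i\<in>I. \<sigma> i * ln (w i)) = ln (\<Sum>i\<in>I. w i)"
proof -
  define Z where "Z = (\<Sum>i\<in>I. w i)"
  have Z: "Z > 0"
    unfolding Z_def using assms by (intro sum_pos) auto
  have "(\<Sum>i\<in>I. \<sigma> i * ln (\<sigma> i)) = (\<Sum>i\<in>I. \<sigma> i * ln (w i) - \<sigma> i * ln Z)"
    using \<sigma> w Z by (intro sum.cong) (auto simp: ln_div right_diff_distrib diff_divide_distrib simp flip: Z_def)
  moreover have "(\<Sum>i\<in>I. \<sigma> i) = 1"
    using \<sigma> Z by (simp flip: Z_def sum_divide_distrib)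
  ultimately show ?thesis
    by (simp add: entropy_def sum_subtractf flip: Z_def sum_distrib_right)
qed

text \<open>Otherwise a short move from \<open>x\<close> towards \<open>y\<close> would decrease
  \<open>f\<close>, while convexity keeps the moved point in \<open>S\<close>. This also covers
  minimisers at an endpoint of an interval, where \<open>D\<close> may be nonzero.\<close>

lemma first_order_condition:
  fixes f :: "real \<Rightarrow> real"
  assumes deriv: "(f has_real_derivative D) (at x)"
    and S: "convex S" "x \<in> S" "y \<in> S" and min: "\<And>z. z \<in> S \<Longrightarrow> f x \<le> f z"
  shows "D * (y - x) \<ge> 0"
proof (rule ccontr)
  assume "\<not> ?thesis"
  then have neg: "D * (y - x) < 0" by simp
  have "((\<lambda>t. f (x + t * (y - x))) has_real_derivative D * (y - x)) (at 0)"
    by (rule DERIV_chain'[where g = f]) (auto intro!: derivative_eq_intros simp: deriv)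
  from DERIV_neg_dec_right[OF this neg] obtain d where d: "d > 0"
    "\<And>h. \<lbrakk>h > 0; h < d\<rbrakk> \<Longrightarrow> f (x + h * (y - x)) < f x"
    by auto
  \<comment> \<open>The bound \<open>d / 2\<close> keeps \<open>h\<close> strictly below
    \<open>d\<close>; the bound 1 keeps the point on the segment from \<open>x\<close> to
    \<open>y\<close>.\<close>
  define h where "h = min (d / 2) 1"
  have h: "0 < h" "h < d" "h \<le> 1"
    using d(1) by (auto simp: h_def)
  have "(1 - h) *\<^sub>R x + h *\<^sub>R y \<in> S"
    using S h by (intro convexD) auto
  then have "x + h * (y - x) \<in> S"
    by (simp add: algebra_simps)
  from min[OF this] d(2)[OF h(1,2)] show False by simp
qed

lemma is_arg_min_INF_eq:
  fixes f :: "'a \<Rightarrow> real"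
  assumes "is_arg_min f (\<lambda>x. x \<in> S) x"
  shows "(INF x\<in>S. f x) = f x"
  using assms by (intro cInf_eq_minimum) (auto simp: is_arg_min_linorder)

lemma is_arg_max_SUP_eq:
  fixes f :: "'a \<Rightarrow> real"
  assumes "is_arg_max f (\<lambda>x. x \<in> S) x"
  shows "(SUP x\<in>S. f x) = f x"
  using assms by (intro cSup_eq_maximum) (auto simp: is_arg_max_linorder)

lemma finite_occupied [simp]: "finite (occupied m \<Lambda>)"
  by (simp add: occupied_def)

lemma occupied_nonempty:
  assumes "\<Lambda> \<subseteq> {0..<m} \<times> B" and "finite B" and "\<Lambda> \<noteq> {}"
  shows "occupied m \<Lambda> \<noteq> {}"
proof -
  obtain i j where ij: "(i, j) \<in> \<Lambda>"
    using assms(3) by auto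
  \<comment> \<open>An infinite set would have \<open>card\<close> 0, so a nonempty row has positive
    count only once it is known to be finite.\<close>
  have "finite {j. (i, j) \<in> \<Lambda>}"
    using assms by (auto intro: finite_subset[of _ B])
  then have "row_count \<Lambda> i > 0"
    using ij by (auto simp: row_count_def card_gt_0_iff)
  then show ?thesis
    using ij assms(1) by (force simp: occupied_def)
qed

text \<open>Turns the mean in the Gibbs lemmas, taken with weights \<open>N\<^sub>i powr l\<close>,
  into the linear term of \<open>tilted\<close>.\<close>

lemma mean_log_count_powr:
  "(\<Sum>i\<in>occupied m \<Lambda>. \<sigma> i * ln (real (row_count \<Lambda> i) powr l)) = l * mean_log_count m \<Lambda> \<sigma>"
  by (auto simp: mean_log_count_def sum_distrib_left occupied_def ln_powr intro!: sum.cong)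

lemma tilted_affine:
  "tilted m n \<Lambda> u \<sigma> l =
     tilted m n \<Lambda> u \<sigma> 0 + l * (mean_log_count m \<Lambda> \<sigma> - log_eta m \<Lambda> u)"
  by (simp add: tilted_def algebra_simps)

text \<open>An affine function on the unit interval is minimal at the endpoint selected by the sign
  of its slope.\<close>

lemma is_arg_min_tilted:
  "is_arg_min (tilted m n \<Lambda> u \<sigma>) (\<lambda>l. l \<in> {0..1})
     (if log_eta m \<Lambda> u \<le> mean_log_count m \<Lambda> \<sigma> then 0 else 1)"
proof -
  define s where "s = mean_log_count m \<Lambda> \<sigma> - log_eta m \<Lambda> u"
  have "(if 0 \<le> s then 0 else 1) * s \<le> l * s" if "l \<in> {0..1}" for l
    using that mult_right_mono_neg[of l 1 s] by auto
  then show ?thesis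
    unfolding is_arg_min_linorder tilted_affine[where l = "if _ then _ else _"]
    by (subst (2) tilted_affine) (auto simp: s_def)
qed

text \<open>Beyond the common terms, the endpoint 0 contributes \<open>log_eta\<close> and the
  endpoint 1 contributes \<open>mean_log_count\<close>; the minimising endpoint yields the
  smaller.\<close>

lemma INF_tilted_eq_truncated: "(INF l\<in>{0..1}. tilted m n \<Lambda> u \<sigma> l) = truncated m n \<Lambda> u \<sigma>"
  by (subst is_arg_min_INF_eq[OF is_arg_min_tilted])
    (auto simp: tilted_def truncated_def algebra_simps)

lemma tilted_le_pressure:
  assumes "\<sigma> \<in> prob_vectors (occupied m \<Lambda>)"
  shows "tilted m n \<Lambda> u \<sigma> l \<le> pressure m n \<Lambda> u l"
proof -
  have "entropy (occupied m \<Lambda>) \<sigma> + (\<Sum>i\<in>occupied m \<Lambda>. \<sigma> i * ln (real (row_count \<Lambda> i) powr l))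
      \<le> ln (\<Sum>i\<in>occupied m \<Lambda>. real (row_count \<Lambda> i) powr l)"
    using assms by (intro entropy_add_mean_le_ln_sum) (auto simp: prob_vectors_def occupied_def)
  then show ?thesis
    unfolding mean_log_count_powr by (simp add: tilted_def pressure_def)
qed

text \<open>The restricted abstraction makes the vector extensional, as membership in
  \<open>prob_vectors\<close> demands.\<close>

definition gibbs_vector :: "nat \<Rightarrow> (nat \<times> nat) set \<Rightarrow> real \<Rightarrow> nat \<Rightarrow> real" where
  "gibbs_vector m \<Lambda> l = (\<lambda>i\<in>occupied m \<Lambda>.
     real (row_count \<Lambda> i) powr l / (\<Sum>i\<in>occupied m \<Lambda>. real (row_count \<Lambda> i) powr l))"

context
  fixes m :: nat and \<Lambda> :: "(nat \<times> nat) set"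
  assumes nonempty: "occupied m \<Lambda> \<noteq> {}"
begin

lemma partition_function_pos: "(\<Sum>i\<in>occupied m \<Lambda>. real (row_count \<Lambda> i) powr l) > 0"
  using nonempty by (intro sum_pos) (auto simp: occupied_def)

lemma gibbs_vector_in_prob_vectors: "gibbs_vector m \<Lambda> l \<in> prob_vectors (occupied m \<Lambda>)"
  using partition_function_pos[of l]
  by (auto simp: prob_vectors_def gibbs_vector_def simp flip: sum_divide_distrib
      intro!: divide_nonneg_pos)

lemma tilted_gibbs_vector: "tilted m n \<Lambda> u (gibbs_vector m \<Lambda> l) l = pressure m n \<Lambda> u l"
proof -
  have "entropy (occupied m \<Lambda>) (gibbs_vector m \<Lambda> l)
      + (\<Sum>i\<in>occupied m \<Lambda>. gibbs_vector m \<Lambda> l i * ln (real (row_count \<Lambda> i) powr l))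
      = ln (\<Sum>i\<in>occupied m \<Lambda>. real (row_count \<Lambda> i) powr l)"
    using nonempty
    by (intro entropy_add_mean_gibbs) (auto simp: gibbs_vector_def occupied_def)
  then show ?thesis
    unfolding mean_log_count_powr by (simp add: tilted_def pressure_def)
qed

text \<open>The logarithmic derivative of the partition function is the mean of
  \<open>ln N\<^sub>i\<close> under the Gibbs vector. It is two-sided at every real
  \<open>l\<close>, hence also at 0 and 1.\<close>

lemma has_real_derivative_pressure:
  "(pressure m n \<Lambda> u has_real_derivative
      mean_log_count m \<Lambda> (gibbs_vector m \<Lambda> l) - log_eta m \<Lambda> u) (at l)"
proof -
  let ?I = "occupied m \<Lambda>" and ?N = "\<lambda>i. real (row_count \<Lambda> i)"
  have "(\<Sum>i\<in>?I. ln (?N i) * ?N i powr l) / (\<Sum>i\<in>?I. ?N i powr l)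
      = mean_log_count m \<Lambda> (gibbs_vector m \<Lambda> l)"
    by (simp add: mean_log_count_def gibbs_vector_def sum_divide_distrib mult.commute)
  then show ?thesis
    unfolding pressure_def[abs_def]
    by (auto intro!: derivative_eq_intros partition_function_pos)
qed

lemma ex_is_arg_min_pressure: "\<exists>l. is_arg_min (pressure m n \<Lambda> u) (\<lambda>l. l \<in> {0..1}) l"
proof -
  have "continuous_on {0..1} (pressure m n \<Lambda> u)"
    using has_real_derivative_pressure
    by (intro continuous_at_imp_continuous_on) (blast intro: DERIV_isCont)
  then have "\<exists>l\<in>{0..1}. \<forall>l'\<in>{0..1}. pressure m n \<Lambda> u l \<le> pressure m n \<Lambda> u l'"
    by (intro continuous_attains_inf) auto
  then show ?thesis
    by (auto simp: is_arg_min_linorder)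
qed

lemma truncated_gibbs_vector:
  assumes "is_arg_min (pressure m n \<Lambda> u) (\<lambda>l. l \<in> {0..1}) l"
  shows "truncated m n \<Lambda> u (gibbs_vector m \<Lambda> l) = pressure m n \<Lambda> u l"
proof -
  let ?\<sigma> = "gibbs_vector m \<Lambda> l"
  have "(mean_log_count m \<Lambda> ?\<sigma> - log_eta m \<Lambda> u) * (l' - l) \<ge> 0" if "l' \<in> {0..1}" for l'
    using assms that
    by (intro first_order_condition[OF has_real_derivative_pressure, of "{0..1}"])
      (auto simp: is_arg_min_linorder)
  \<comment> \<open>By affinity, the product just shown to be nonnegative is exactly the difference
    of these two values.\<close>
  then have "tilted m n \<Lambda> u ?\<sigma> l \<le> tilted m n \<Lambda> u ?\<sigma> l'" if "l' \<in> {0..1}" for l'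
    using that tilted_affine[of m n \<Lambda> u ?\<sigma> l] tilted_affine[of m n \<Lambda> u ?\<sigma> l']
    by (fastforce simp: algebra_simps)
  then have "is_arg_min (tilted m n \<Lambda> u ?\<sigma>) (\<lambda>l. l \<in> {0..1}) l"
    using assms by (auto simp: is_arg_min_linorder)
  from is_arg_min_INF_eq[OF this] show ?thesis
    by (simp add: INF_tilted_eq_truncated tilted_gibbs_vector)
qed

text \<open>Every \<open>\<sigma>\<close> satisfies
  \<open>truncated \<sigma> \<le> tilted \<sigma> l \<le> pressure l\<close>, and the Gibbs vector
  attains the last value.\<close>

lemma is_arg_max_truncated:
  assumes "is_arg_min (pressure m n \<Lambda> u) (\<lambda>l. l \<in> {0..1}) l"
  shows "is_arg_max (truncated m n \<Lambda> u) (\<lambda>\<sigma>. \<sigma> \<in> prob_vectors (occupied m \<Lambda>))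
    (gibbs_vector m \<Lambda> l)"
proof -
  have "truncated m n \<Lambda> u \<sigma> \<le> truncated m n \<Lambda> u (gibbs_vector m \<Lambda> l)"
    if \<sigma>: "\<sigma> \<in> prob_vectors (occupied m \<Lambda>)" for \<sigma>
  proof -
    \<comment> \<open>A real infimum is a lower bound only for a set bounded below; the attained
      minimum supplies the bound.\<close>
    have "bdd_below (tilted m n \<Lambda> u \<sigma> ` {0..1})"
      using is_arg_min_tilted[of m n \<Lambda> u \<sigma>] unfolding is_arg_min_linorder
      by (intro bdd_belowI2) blast
    then have "truncated m n \<Lambda> u \<sigma> \<le> tilted m n \<Lambda> u \<sigma> l"
      using assms unfolding INF_tilted_eq_truncated[symmetric]
      by (intro cINF_lower) (auto simp: is_arg_min_linorder)
    also have "\<dots> \<le> pressure m n \<Lambda> u l"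
      using \<sigma> by (rule tilted_le_pressure)
    finally show ?thesis
      by (simp add: truncated_gibbs_vector[OF assms])
  qed
  then show ?thesis
    by (simp add: is_arg_max_linorder gibbs_vector_in_prob_vectors)
qed

end

theorem lemma5p1:
  fixes m n :: nat and \<Lambda> :: "(nat \<times> nat) set" and u :: int
  assumes "n \<ge> 2" and "m > n"
    and "\<Lambda> \<subseteq> {0..m-1} \<times> {0..n-1}" and "\<Lambda> \<noteq> {}"
  defines "P \<equiv> prob_vectors (occupied m \<Lambda>)"
  shows "(\<exists>l. is_arg_min (pressure m n \<Lambda> u) (\<lambda>l. l \<in> {0..1}) l)
    \<and> (\<forall>\<sigma>\<in>P. \<exists>l. is_arg_min (tilted m n \<Lambda> u \<sigma>) (\<lambda>l. l \<in> {0..1}) l)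
    \<and> (\<exists>\<sigma>. is_arg_max (\<lambda>\<sigma>. INF l\<in>{0..1}. tilted m n \<Lambda> u \<sigma> l) (\<lambda>\<sigma>. \<sigma> \<in> P) \<sigma>)
    \<and> (\<exists>\<sigma>. is_arg_max (truncated m n \<Lambda> u) (\<lambda>\<sigma>. \<sigma> \<in> P) \<sigma>)
    \<and> Delta m n \<Lambda> u = 1 / ln (real m) * (SUP \<sigma>\<in>P. INF l\<in>{0..1}. tilted m n \<Lambda> u \<sigma> l)
    \<and> (1 / ln (real m) * (SUP \<sigma>\<in>P. INF l\<in>{0..1}. tilted m n \<Lambda> u \<sigma> l)
         = 1 / ln (real m) * (SUP \<sigma>\<in>P. truncated m n \<Lambda> u \<sigma>))"
proof -
  \<comment> \<open>Subtraction on naturals is harmless here, since \<open>m > n\<close> forces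
    \<open>m > 0\<close>.\<close>
  have "{0..m-1} = {0..<m}"
    using assms(2) by auto
  then have nonempty: "occupied m \<Lambda> \<noteq> {}"
    using assms(3,4) by (intro occupied_nonempty[of _ _ "{0..n-1}"]) auto
  obtain l where l: "is_arg_min (pressure m n \<Lambda> u) (\<lambda>l. l \<in> {0..1}) l"
    using ex_is_arg_min_pressure[OF nonempty] by blast
  note max = is_arg_max_truncated[OF nonempty l, folded P_def]
  \<comment> \<open>Both extrema equal the pressure at \<open>l\<close>: the infimum is attained
    there, the supremum at its Gibbs vector.\<close>
  have "Delta m n \<Lambda> u = 1 / ln (real m) * (SUP \<sigma>\<in>P. truncated m n \<Lambda> u \<sigma>)"
    by (simp add: Delta_def is_arg_min_INF_eq[OF l] is_arg_max_SUP_eq[OF max]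
        truncated_gibbs_vector[OF nonempty l])
  then show ?thesis
    unfolding INF_tilted_eq_truncated using l max is_arg_min_tilted by blast
qed

end
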